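(* Let $\mathcal T$ be a vertex-convex simplicial mesh of $\Omega\subset\mathbb R^d$, let $k\ge 1$ and $0\le \ell\le d$, and let $\bm p\in\mathcal X_k^\ell(\mathcal T)$, with $f=\mathrm{Conv}(\bm v_0^f,\dots,\bm v_\ell^f)\in\Delta_\ell(\mathcal T)$, $\bm p\in\mathring f$ and $\bm p=\frac1k\sum_{i=0}^\ell\alpha_i\bm v_i^f$, where the vertices of each $T_{i'}$, $i'\in I_{\bm p}$, are ordered so that the first $\ell+1$ of them are $\bm v_0^f,\dots,\bm v_\ell^f$. Then the global $P_k$ Lagrange basis function $\varphi_{\bm p}$ satisfies, for all $\bm x\in\Omega$, $$\varphi_{\bm p}(\bm x)=\frac{1}{\bm\alpha!}\,\min_{i'\in I_{\bm p}}\left\{\prod_{i=0}^\ell k\,\mathrm{ReLU}(\lambda_{i',i}(\bm x))\right\}\times\prod_{i=0}^\ell\prod_{j=1}^{\alpha_i-1}\left(k\min_{i'\in I_{\bm p}}\{\lambda_{i',i}(\bm x)\}-j\right),$$ where $\lambda_{i',i}$ is the barycentric coordinate function of the $i$-th vertex of $T_{i'}$, regarded as an affine function on $\mathbb R^d$.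
   Context: $\mathrm{ReLU}(t)=\max\{0,t\}$. $\Omega\subset\mathbb R^d$ is a bounded polytope domain. A simplicial mesh $\mathcal T=\{T_1,\dots,T_N\}$ of $\Omega$ is a finite set of (closed, nondegenerate) $d$-dimensional simplices with $\Omega=\bigcup_{T\in\mathcal T}T$ such that any two of them intersect in the empty set or in a common sub-simplex (face). $\Delta_\ell(T)$ is the set of $\ell$-dimensional sub-simplices of $T$ (convex hulls of $\ell+1$ of its vertices), and $\Delta_\ell(\mathcal T)=\bigcup_{T\in\mathcal T}\Delta_\ell(T)$. For $S\subseteq\Omega$: $I_S=\{i:S\subseteq T_i\}$ and $P_S=\bigcup_{i\in I_S}T_i$; write $I_{\bm x},P_{\bm x}$ when $S=\{\bm x\}$. The mesh is vertex-convex if $P_{\bm v}$ is convex for every vertex $\bm v\in\Delta_0(\mathcal T)$. For a simplex $T=\mathrm{Conv}(\bm v_0,\dots,\bm v_d)$ the barycentric coordinate functions $\lambda_0,\dots,\lambda_d$ are the affine functions with $\sum_i\lambda_i=1$ and $\bm x=\sum_i\lambda_i(\bm x)\bm v_i$; for $T=T_s$ they are written $\lambda_{s,i}$. $\mathcal X_k(T)=\{\frac1k\sum_{i=0}^d\alpha_i\bm v_i:\bm\alpha\in\mathbb N^{d+1},\ |\bm\alpha|=\sum_i\alpha_i=k\}$ (with $0\in\mathbb N$), and $\mathcal X_k(\mathcal T)=\bigcup_T\mathcal X_k(T)$. $\mathring f$ is the relative interior of a sub-simplex $f$ ($\mathring f=f$ if $f$ is a vertex), and $\mathcal X_k^\ell(\mathcal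 T)$ is the set of points of $\mathcal X_k(\mathcal T)$ lying in $\mathring f$ for some $f\in\Delta_\ell(\mathcal T)$. For such $\bm p\in\mathring f$, $f=\mathrm{Conv}(\bm v^f_0,\dots,\bm v^f_\ell)$, there are unique positive integers $\alpha_0,\dots,\alpha_\ell$ with $\sum_i\alpha_i=k$ and $\bm p=\frac1k\sum_i\alpha_i\bm v_i^f$; also $I_{\bm p}=I_f$. For each $s\in I_{\bm p}$ the vertices of $T_s$ are ordered (indices $0,\dots,d$) so that vertices $0,\dots,\ell$ are $\bm v_0^f,\dots,\bm v_\ell^f$; thus in each $T_s$ the point $\bm p$ has index $\bm\alpha=(\alpha_0,\dots,\alpha_\ell,0,\dots,0)$, and $\bm\alpha!=\prod_i\alpha_i!$. The global $P_k$ Lagrange basis function $\varphi_{\bm p}$ is: $\varphi_{\bm p}(\bm x)=0$ if $\bm x\notin P_{\bm p}$, and $\varphi_{\bm p}(\bm x)=\frac{1}{\bm\alpha!}\prod_{i=0}^{d}\prod_{j=0}^{\alpha_i-1}(k\lambda_{s,i}(\bm x)-j)$ if $\bm x\in T_s$, $s\in I_{\bm p}$. (Empty products equal 1.) *)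

theory Defs
  imports "HOL-Analysis.Analysis"
begin

definition ReLU :: "real \<Rightarrow> real" where
  "ReLU t = max 0 t"

definition vertices :: "'a::euclidean_space set \<Rightarrow> 'a set" where
  "vertices T = {v. v extreme_point_of T}"

definition subsimplices :: "nat \<Rightarrow> 'a::euclidean_space set \<Rightarrow> 'a set set" where
  "subsimplices l T = {convex hull C | C. C \<subseteq> vertices T \<and> card C = l + 1}"

definition mesh_subsimplices :: "nat \<Rightarrow> 'a::euclidean_space set set \<Rightarrow> 'a set set" where
  "mesh_subsimplices l \<T> = (\<Union>T\<in>\<T>. subsimplices l T)"

text \<open>
  As usual for finite elements, the closure of the domain is again called the domain: it has to be
  closed, being a union of closed simplices. The polytope need not be convex.
\<close>
definition bounded_polytope_domain :: "'a::euclidean_space set \<Rightarrow> bool" where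
  "bounded_polytope_domain \<Omega> \<longleftrightarrow>
     bounded \<Omega> \<and>
     (\<exists>P. finite P \<and> (\<forall>Q\<in>P. polytope Q) \<and> \<Omega> = \<Union>P) \<and>
     (\<exists>D. open D \<and> connected D \<and> D \<noteq> {} \<and> \<Omega> = closure D)"

definition simplicial_mesh :: "'a::euclidean_space set set \<Rightarrow> 'a set \<Rightarrow> bool" where
  "simplicial_mesh \<T> \<Omega> \<longleftrightarrow>
     finite \<T> \<and>
     (\<forall>T\<in>\<T>. int DIM('a) simplex T) \<and>
     \<Omega> = \<Union>\<T> \<and>
     (\<forall>T\<in>\<T>. \<forall>T'\<in>\<T>. T \<inter> T' = {} \<or> (\<exists>m. T \<inter> T' \<in> subsimplices m T \<inter> subsimplices m T'))"

text \<open>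
  The simplices of a mesh are indexed by themselves, so \<^term>\<open>star \<T> S\<close> is the index set $I_S$
  and \<^term>\<open>patch \<T> S\<close> the set $P_S$.
\<close>
definition star :: "'a set set \<Rightarrow> 'a set \<Rightarrow> 'a set set" where
  "star \<T> S = {T\<in>\<T>. S \<subseteq> T}"

definition patch :: "'a set set \<Rightarrow> 'a set \<Rightarrow> 'a set" where
  "patch \<T> S = \<Union>(star \<T> S)"

definition vertex_convex :: "'a::euclidean_space set set \<Rightarrow> bool" where
  "vertex_convex \<T> \<longleftrightarrow> (\<forall>f\<in>mesh_subsimplices 0 \<T>. convex (patch \<T> f))"

text \<open>
  Barycentric coordinates are indexed by the vertices themselves. The last conjunct only fixes the
  irrelevant values at points that are not vertices, which makes the family unique.
\<close>
definition barycentric_family :: "'a::euclidean_space set \<Rightarrow> ('a \<Rightarrow> 'a \<Rightarrow> real) \<Rightarrow> bool" where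
  "barycentric_family T lam \<longleftrightarrow>
     (\<forall>v\<in>vertices T. \<exists>a b. \<forall>x. lam v x = a \<bullet> x + b) \<and>
     (\<forall>x. (\<Sum>v\<in>vertices T. lam v x) = 1) \<and>
     (\<forall>x. x = (\<Sum>v\<in>vertices T. lam v x *\<^sub>R v)) \<and>
     (\<forall>v. v \<notin> vertices T \<longrightarrow> lam v = (\<lambda>x. 0))"

definition barycentric :: "'a::euclidean_space set \<Rightarrow> 'a \<Rightarrow> 'a \<Rightarrow> real" where
  "barycentric T = (THE lam. barycentric_family T lam)"

lemma barycentric_family_unique_exists:
  fixes T :: "'a::euclidean_space set"
  assumes "int DIM('a) simplex T"
  shows "\<exists>!lam. barycentric_family T lam"
proof -
  obtain C where C: "\<not> affine_dependent C" "int (card C) = int DIM('a) + 1" "T = convex hull C"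
    using assms unfolding simplex_def by blast
  have fin: "finite C"
    using C(1) aff_independent_finite by blast
  have vert: "vertices T = C"
    using C extreme_point_of_convex_hull_affine_independent unfolding vertices_def by blast
  have span: "affine hull C = UNIV"
    using C affine_independent_span_eq[of C] by simp
  have uniq: "u v = w v"
    if "sum u C = 1" "sum w C = 1" "(\<Sum>v\<in>C. u v *\<^sub>R v) = (\<Sum>v\<in>C. w v *\<^sub>R v)" "v \<in> C"
    for u w :: "'a \<Rightarrow> real" and v
  proof (rule ccontr)
    assume "u v \<noteq> w v"
    moreover have "(\<Sum>v\<in>C. u v - w v) = 0"
      using that by (simp add: sum_subtractf)
    moreover have "(\<Sum>v\<in>C. (u v - w v) *\<^sub>R v) = 0"
      using that by (simp add: scaleR_left_diff_distrib sum_subtractf)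
    ultimately have "affine_dependent C"
      unfolding affine_dependent_explicit_finite[OF fin]
      using \<open>v \<in> C\<close> by (intro exI[of _ "\<lambda>v. u v - w v"]) auto
    then show False using C(1) by blast
  qed
  have "\<exists>u. sum u C = 1 \<and> (\<Sum>v\<in>C. u v *\<^sub>R v) = x" for x
    using span affine_hull_finite[OF fin] by blast
  then obtain U where U: "\<And>x. sum (U x) C = 1" "\<And>x. (\<Sum>v\<in>C. U x v *\<^sub>R v) = x"
    by metis
  define L where "L v x = (if v \<in> C then U x v else 0)" for v x
  have aff: "\<exists>a b. \<forall>x. L v x = a \<bullet> x + b" if v: "v \<in> C" for v
  proof -
    define g where "g x = U x v - U 0 v" for x
    have "linear g"
    proof (rule linearI)
      fix x y
      have "U (x + y) v = U x v + U y v - U 0 v"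
        by (rule uniq[OF _ _ _ v])
          (simp_all add: sum.distrib sum_subtractf U scaleR_left_distrib scaleR_left_diff_distrib)
      then show "g (x + y) = g x + g y" by (simp add: g_def)
    next
      fix r x
      have "U (r *\<^sub>R x) v = r * U x v + (1 - r) * U 0 v"
        by (rule uniq[OF _ _ _ v])
          (simp_all add: sum.distrib U scaleR_left_distrib
            flip: sum_distrib_left scaleR_scaleR scaleR_right.sum)
      then show "g (r *\<^sub>R x) = r *\<^sub>R g x" by (simp add: g_def algebra_simps)
    qed
    have "g x = adjoint g 1 \<bullet> x" for x
      using adjoint_works[OF \<open>linear g\<close>, of x 1] by (simp add: inner_commute)
    then have "L v x = adjoint g 1 \<bullet> x + U 0 v" for x
      using v unfolding L_def g_def by (metis diff_add_cancel)
    then show ?thesis by blast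
  qed
  show ?thesis
  proof (rule ex1I[of _ L])
    show "barycentric_family T L"
      unfolding barycentric_family_def vert using aff U by (auto simp: L_def)
  next
    fix M assume M: "barycentric_family T M"
    show "M = L"
    proof (intro ext)
      fix v x
      show "M v x = L v x"
      proof (cases "v \<in> C")
        case True
        have "M v x = U x v"
          by (rule uniq[OF _ _ _ True, of "\<lambda>v. M v x"])
            (use M U in \<open>auto simp: barycentric_family_def vert\<close>)
        then show ?thesis using True by (simp add: L_def)
      next
        case False
        then show ?thesis using M by (simp add: barycentric_family_def vert L_def)
      qed
    qed
  qed
qed

definition lattice_nodes :: "nat \<Rightarrow> 'a::euclidean_space set \<Rightarrow> 'a set" where
  "lattice_nodes k T =
     {(1 / real k) *\<^sub>R (\<Sum>v\<in>vertices T. real (\<alpha> v) *\<^sub>R v) | \<alpha> :: 'a \<Rightarrow> nat.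
        (\<Sum>v\<in>vertices T. \<alpha> v) = k}"

definition mesh_nodes :: "nat \<Rightarrow> 'a::euclidean_space set set \<Rightarrow> 'a set" where
  "mesh_nodes k \<T> = (\<Union>T\<in>\<T>. lattice_nodes k T)"

definition mesh_nodes_dim :: "nat \<Rightarrow> nat \<Rightarrow> 'a::euclidean_space set set \<Rightarrow> 'a set" where
  "mesh_nodes_dim k l \<T> = {p \<in> mesh_nodes k \<T>. \<exists>f\<in>mesh_subsimplices l \<T>. p \<in> rel_interior f}"

text \<open>
  \<^term>\<open>V T 0\<close>, \<dots>, \<^term>\<open>V T d\<close> is the chosen ordering of the vertices of \<^term>\<open>T\<close>, and
  \<^term>\<open>\<alpha>\<close> the index of \<^term>\<open>p\<close> with respect to it, on every \<^term>\<open>T\<close> containing \<^term>\<open>p\<close>.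
  The value at \<^term>\<open>x\<close> is the common value of the local formulas on the simplices of the patch
  that contain \<^term>\<open>x\<close>.
\<close>
definition lagrange_local ::
    "nat \<Rightarrow> ('a::euclidean_space set \<Rightarrow> nat \<Rightarrow> 'a) \<Rightarrow> (nat \<Rightarrow> nat) \<Rightarrow> 'a set \<Rightarrow> 'a \<Rightarrow> real" where
  "lagrange_local k V \<alpha> T x =
     1 / (\<Prod>i\<le>DIM('a). fact (\<alpha> i)) *
     (\<Prod>i\<le>DIM('a). \<Prod>j<\<alpha> i. real k * barycentric T (V T i) x - real j)"

definition lagrange_basis ::
    "'a::euclidean_space set set \<Rightarrow> nat \<Rightarrow> ('a set \<Rightarrow> nat \<Rightarrow> 'a) \<Rightarrow> (nat \<Rightarrow> nat) \<Rightarrow> 'a \<Rightarrow> 'a \<Rightarrow> real"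
  where
  "lagrange_basis \<T> k V \<alpha> p x =
     (if x \<in> patch \<T> {p}
      then THE y. \<forall>T\<in>star \<T> {p}. x \<in> T \<longrightarrow> y = lagrange_local k V \<alpha> T x
      else 0)"

end

theory Submission
  imports Defs
begin

text \<open>
  Convexity of the star of a vertex \<open>v\<close> makes the hyperplane of every facet opposite \<open>v\<close> a supporting
  one, so the barycentric coordinates of \<open>v\<close> are nonnegative on the whole star, and on a simplex \<open>T\<close>
  the coordinate taken from \<open>T\<close> itself is the smallest. This identifies both sides on \<open>P\<^sub>p\<close>. Off \<open>P\<^sub>p\<close>
  one of the ReLU products has to vanish. This is a global statement about \<open>\<Omega>\<close>, which is convex, being
  connected and locally convex: if all coordinates at \<open>x\<close> were positive, the segment from \<open>p\<close> to \<open>x\<close>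
  could never leave \<open>P\<^sub>p\<close>, because at an exit point \<open>q\<close> every simplex containing \<open>q\<close> has all the
  vertices of \<open>f\<close> and hence contains \<open>p\<close>.
\<close>

section \<open>Convexity from local convexity\<close>

text \<open>Apollonius' identity with its surplus kept: the term in
  \<open>dist c (midpoint a b)\<close> is the energy saved by moving \<open>c\<close> to the
  midpoint, so an optimal \<open>c\<close> must already be there.\<close>

lemma midpoint_energy:
  fixes a b c :: "'a::real_inner"
  shows "(dist a c)\<^sup>2 + (dist c b)\<^sup>2 =
    (dist a (midpoint a b))\<^sup>2 + (dist (midpoint a b) b)\<^sup>2 + 2 * (dist c (midpoint a b))\<^sup>2"
proof -
  have e: "(dist u v)\<^sup>2 = inner (u - v) (u - v)" for u v :: 'a
    by (simp add: dist_norm power2_norm_eq_inner)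
  show ?thesis
    unfolding e midpoint_def
    by (simp add: algebra_simps inner_commute)
qed

text \<open>Tychonoff's theorem for sequences in \<open>S\<close>, cut down by closed conditions on
  single coordinates or neighbouring pairs. Asking for \<open>w i \<in> S\<close> beyond
  \<open>n\<close> as well keeps the irrelevant entries in a compact set.\<close>

lemma compact_chains:
  fixes S :: "'a::metric_space set"
  assumes "compact S"
  shows "compact {w :: nat \<Rightarrow> 'a. (\<forall>i. w i \<in> S) \<and> w 0 = x \<and> w n = y \<and>
    (\<forall>i<n. dist (w i) (w (Suc i)) \<le> e)}"
proof -
  have "compact (PiE UNIV (\<lambda>_::nat. S))"
    using assms compactin_PiE[of "\<lambda>_. euclidean" UNIV "\<lambda>_::nat. S"]
    by (simp add: euclidean_product_topology flip: compactin_euclidean_iff)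
  moreover have "closed {w :: nat \<Rightarrow> 'a. w 0 = x \<and> w n = y \<and>
      (\<forall>i<n. dist (w i) (w (Suc i)) \<le> e)}"
  proof -
    have cont: "continuous_on UNIV (\<lambda>w :: nat \<Rightarrow> 'a. w i)" for i
      by (rule continuous_on_product_coordinates)
    have "{w :: nat \<Rightarrow> 'a. w 0 = x \<and> w n = y \<and> (\<forall>i<n. dist (w i) (w (Suc i)) \<le> e)} =
        {w. w 0 = x} \<inter> {w. w n = y} \<inter> (\<Inter>i\<in>{..<n}. {w. dist (w i) (w (Suc i)) \<le> e})"
      by auto
    also have "closed \<dots>"
      by (intro closed_Int closed_INT ballI closed_Collect_eq closed_Collect_le
          continuous_on_dist continuous_on_const cont)
    finally show ?thesis .
  qed
  ultimately have "compact (PiE UNIV (\<lambda>_. S) \<inter> {w :: nat \<Rightarrow> 'a. w 0 = x \<and> w n = y \<and>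
      (\<forall>i<n. dist (w i) (w (Suc i)) \<le> e)})"
    by (rule compact_Int_closed)
  then show ?thesis
    by (rule back_subst[of compact]) auto
qed

text \<open>Reachability within \<open>S\<close> by steps of length at most \<open>e\<close> is an
  equivalence relation with relatively open classes, so connectedness leaves a single class.\<close>

lemma connected_imp_fine_chain:
  fixes S :: "'a::metric_space set"
  assumes "connected S" "x \<in> S" "y \<in> S" "e > 0"
  obtains w :: "nat \<Rightarrow> 'a" and n where "\<And>i. w i \<in> S" "w 0 = x" "w n = y"
    "\<And>i. i < n \<Longrightarrow> dist (w i) (w (Suc i)) \<le> e"
proof -
  define R where "R = (\<lambda>a b. a \<in> S \<and> b \<in> S \<and> dist a b \<le> e)"
  have symR: "symp R"
    by (auto simp: R_def symp_def dist_commute)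
  have "R\<^sup>*\<^sup>* x y"
  proof (rule connected_equivalence_relation[OF assms(1-3)])
    show "R\<^sup>*\<^sup>* a b \<Longrightarrow> R\<^sup>*\<^sup>* b a" for a b
      using symp_rtranclp[OF symR] by (rule sympD)
    show "\<exists>T. openin (top_of_set S) T \<and> a \<in> T \<and> (\<forall>b\<in>T. R\<^sup>*\<^sup>* a b)" if "a \<in> S" for a
      using that \<open>e > 0\<close>
      by (intro exI[of _ "S \<inter> ball a e"]) (auto simp: R_def openin_open_Int)
  qed auto
  then obtain n where "(R ^^ n) x y"
    using rtranclp_imp_relpowp by metis
  then obtain g where g: "g 0 = x" "g n = y" "\<And>i. i < n \<Longrightarrow> R (g i) (g (Suc i))"
    unfolding relpowp_fun_conv by blast
  have gS: "g i \<in> S" if "i \<le> n" for i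
    using that g(2,3) \<open>y \<in> S\<close> by (cases "i = n") (auto simp: R_def)
  \<comment> \<open>Freezing the chain at index \<open>n\<close> keeps all later entries in
    \<open>S\<close>.\<close>
  show thesis
    by (rule that[of "\<lambda>i. g (min i n)" n])
      (use g gS in \<open>auto simp: R_def min_def Suc_le_eq\<close>)
qed

text \<open>
  The Tietze--Nakajima theorem in the compact case: among the fine chains in \<open>S\<close> from \<open>x\<close> to \<open>y\<close>
  one of least energy \<open>\<Sum>|w\<^sub>i - w\<^sub>i\<^sub>+\<^sub>1|\<^sup>2\<close> exists, and each of its inner points is the midpoint of its
  neighbours, since replacing it by that midpoint stays in \<open>S\<close> by local convexity.
\<close>
theorem compact_connected_locally_convex_imp_convex:
  fixes S :: "'a::euclidean_space set"
  assumes "compact S" "connected S"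
    and loc: "\<And>x. x \<in> S \<Longrightarrow> \<exists>e>0. convex (S \<inter> ball x e)"
  shows "convex S"
proof -
  \<comment> \<open>A Lebesgue number for the cover by balls with convex trace on \<open>S\<close>
    makes the radius uniform.\<close>
  obtain \<delta> where \<delta>: "\<delta> > 0" and \<delta>_ball: "\<And>x. x \<in> S \<Longrightarrow> convex (S \<inter> ball x \<delta>)"
  proof -
    define \<G> where "\<G> = {ball x e | x e. convex (S \<inter> ball x e)}"
    have "S \<subseteq> \<Union>\<G>"
    proof
      fix x assume "x \<in> S"
      then obtain e where "e > 0" "convex (S \<inter> ball x e)"
        using loc by blast
      then have "ball x e \<in> \<G>" "x \<in> ball x e"
        by (auto simp: \<G>_def)
      then show "x \<in> \<Union>\<G>" by blast
    qed
    moreover have "open G" if "G \<in> \<G>" for G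
      using that by (auto simp: \<G>_def)
    ultimately obtain \<delta> where "\<delta> > 0" and \<delta>: "\<And>x. x \<in> S \<Longrightarrow> \<exists>G\<in>\<G>. ball x \<delta> \<subseteq> G"
      using Heine_Borel_lemma[OF \<open>compact S\<close>] by metis
    have "convex (S \<inter> ball x \<delta>)" if x: "x \<in> S" for x
    proof -
      obtain G where G: "G \<in> \<G>" "ball x \<delta> \<subseteq> G"
        using \<delta>[OF x] by blast
      then have "convex (S \<inter> G \<inter> ball x \<delta>)"
        by (auto simp: \<G>_def intro!: convex_Int[OF _ convex_ball])
      moreover have "S \<inter> G \<inter> ball x \<delta> = S \<inter> ball x \<delta>"
        using G by blast
      ultimately show ?thesis by simp
    qed
    with \<open>\<delta> > 0\<close> that show thesis by blast
  qed
  \<comment> \<open>Strictly below \<delta>: the step bound is non-strict, so that the set of chains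
    is closed, while the balls are open.\<close>
  define e where "e = \<delta> / 2"
  have e: "0 < e" "e < \<delta>"
    using \<delta> by (auto simp: e_def)
  have "closed_segment x y \<subseteq> S" if xy: "x \<in> S" "y \<in> S" for x y
  proof -
    obtain w0 :: "nat \<Rightarrow> 'a" and n where w0: "\<And>i. w0 i \<in> S" "w0 0 = x" "w0 n = y"
      "\<And>i. i < n \<Longrightarrow> dist (w0 i) (w0 (Suc i)) \<le> e"
      using connected_imp_fine_chain[OF \<open>connected S\<close> xy e(1)] by metis
    define W where "W = {w :: nat \<Rightarrow> 'a. (\<forall>i. w i \<in> S) \<and> w 0 = x \<and> w n = y \<and>
      (\<forall>i<n. dist (w i) (w (Suc i)) \<le> e)}"
    define E where "E w = (\<Sum>i<n. (dist (w i) (w (Suc i)))\<^sup>2)" for w :: "nat \<Rightarrow> 'a"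
    have "\<exists>w\<in>W. \<forall>w'\<in>W. E w \<le> E w'"
    proof (rule continuous_attains_inf)
      show "compact W"
        unfolding W_def by (rule compact_chains[OF \<open>compact S\<close>])
      show "W \<noteq> {}"
        using w0 by (auto simp: W_def)
      show "continuous_on W E"
        unfolding E_def by (intro continuous_on_sum continuous_on_power continuous_on_dist
            continuous_on_subset[OF continuous_on_product_coordinates subset_UNIV])
    qed
    then obtain w where w: "w \<in> W" and least: "\<And>w'. w' \<in> W \<Longrightarrow> E w \<le> E w'"
      by blast
    have wS: "w i \<in> S" for i
      using w by (auto simp: W_def)
    have w_ends: "w 0 = x" "w n = y"
      using w by (auto simp: W_def)
    have w_step: "dist (w i) (w (Suc i)) \<le> e" if "i < n" for i
      using w that by (auto simp: W_def)
    have mid: "w (Suc i) = midpoint (w i) (w (Suc (Suc i)))" if i: "Suc i < n" for i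
    proof -
      let ?a = "w i" and ?b = "w (Suc (Suc i))" and ?c = "w (Suc i)"
      define m where "m = midpoint ?a ?b"
      define w' where "w' = w(Suc i := m)"
      have ac: "dist ?a ?c \<le> e" and cb: "dist ?c ?b \<le> e"
        using w_step i by auto
      have mS: "m \<in> S"
      proof -
        have "?a \<in> S \<inter> ball ?c \<delta>" "?b \<in> S \<inter> ball ?c \<delta>"
          using wS ac cb e by (auto simp: dist_commute)
        then have "closed_segment ?a ?b \<subseteq> S \<inter> ball ?c \<delta>"
          by (rule closed_segment_subset) (rule \<delta>_ball[OF wS])
        moreover have "m \<in> closed_segment ?a ?b"
          by (simp add: m_def)
        ultimately show ?thesis by blast
      qed
      \<comment> \<open>The midpoint halves this distance, so the modified chain is again
        \<open>e\<close>-fine and competes with \<open>w\<close>.\<close>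
      have "dist ?a ?b \<le> 2 * e"
        using dist_triangle[of ?a ?b ?c] ac cb by linarith
      then have am: "dist ?a m \<le> e" and mb: "dist m ?b \<le> e"
        by (auto simp: m_def dist_midpoint)
      have "w' \<in> W"
        using wS w_ends w_step i am mb mS by (auto simp: W_def w'_def)
      then have "E w \<le> E w'"
        by (rule least)
      moreover have split: "E v = (\<Sum>j\<in>{..<n} - {i, Suc i}. (dist (v j) (v (Suc j)))\<^sup>2) +
          (dist (v i) (v (Suc i)))\<^sup>2 + (dist (v (Suc i)) (v (Suc (Suc i))))\<^sup>2" for v
        unfolding E_def using i by (subst sum.subset_diff[of "{i, Suc i}"]) auto
      moreover have "(\<Sum>j\<in>{..<n} - {i, Suc i}. (dist (w' j) (w' (Suc j)))\<^sup>2) =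
          (\<Sum>j\<in>{..<n} - {i, Suc i}. (dist (w j) (w (Suc j)))\<^sup>2)"
        by (rule sum.cong) (auto simp: w'_def)
      moreover have "(dist ?a ?c)\<^sup>2 + (dist ?c ?b)\<^sup>2 =
          (dist ?a m)\<^sup>2 + (dist m ?b)\<^sup>2 + 2 * (dist ?c m)\<^sup>2"
        unfolding m_def by (rule midpoint_energy)
      ultimately have "2 * (dist ?c m)\<^sup>2 \<le> 0"
        by (simp add: w'_def)
      then show ?thesis
        by (simp add: m_def)
    qed
    \<comment> \<open>The midpoint relations make all increments equal: the chain runs straight from
      \<open>x\<close> to \<open>y\<close>, and its short pieces, each inside one ball, are glued in
      order.\<close>
    define d where "d = w 1 - w 0"
    have diff: "w (Suc i) - w i = d" if "i < n" for i
      using that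
    proof (induction i)
      case (Suc i)
      have "2 *\<^sub>R w (Suc i) = w i + w (Suc (Suc i))"
        by (subst mid) (use Suc.prems in \<open>auto simp: midpoint_def\<close>)
      with Suc show ?case
        by (simp add: scaleR_2 algebra_simps)
    qed (simp add: d_def)
    have w_eq: "w i = x + real i *\<^sub>R d" if "i \<le> n" for i
      using that
    proof (induction i)
      case (Suc i)
      then show ?case
        using diff[of i] by (simp add: algebra_simps)
    qed (simp add: w_ends)
    have "closed_segment x (w i) \<subseteq> S" if "i \<le> n" for i
      using that
    proof (induction i)
      case 0
      then show ?case
        by (simp add: w_ends xy)
    next
      case (Suc i)
      have "w i \<in> closed_segment x (w (Suc i))"
      proof -
        define c where "c = real i / real (Suc i)"
        have c: "c * real (Suc i) = real i" "0 \<le> c" "c \<le> 1"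
          by (simp_all add: c_def)
        have "(1 - c) *\<^sub>R x + c *\<^sub>R w (Suc i) = x + (c * real (Suc i)) *\<^sub>R d"
          using Suc.prems
          by (simp add: w_eq scaleR_add_right scaleR_left_diff_distrib del: of_nat_Suc)
        also have "\<dots> = w i"
          using Suc.prems c by (simp add: w_eq)
        finally show ?thesis
          unfolding in_segment using c by metis
      qed
      then have "closed_segment x (w (Suc i)) = closed_segment x (w i) \<union> closed_segment (w i) (w (Suc i))"
        by (simp add: Un_closed_segment)
      moreover have "closed_segment (w i) (w (Suc i)) \<subseteq> S \<inter> ball (w i) \<delta>"
        using \<delta>_ball[OF wS] wS w_step[of i] Suc.prems e \<delta>
        by (intro closed_segment_subset) auto
      ultimately show ?case
        using Suc by auto
    qed
    from this[of n] show ?thesis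
      by (simp add: w_ends)
  qed
  then show ?thesis
    by (simp add: convex_contains_segment)
qed

section \<open>Barycentric coordinates of a simplex\<close>

lemma simplex_vertices:
  fixes T :: "'a::euclidean_space set"
  assumes "n simplex T"
  shows "finite (vertices T)" "\<not> affine_dependent (vertices T)"
    "int (card (vertices T)) = n + 1" "T = convex hull (vertices T)"
proof -
  obtain C where C: "\<not> affine_dependent C" "int (card C) = n + 1" "T = convex hull C"
    using assms unfolding simplex_def by blast
  moreover have "vertices T = C"
    using C extreme_point_of_convex_hull_affine_independent unfolding vertices_def by blast
  ultimately show "finite (vertices T)" "\<not> affine_dependent (vertices T)"
    "int (card (vertices T)) = n + 1" "T = convex hull (vertices T)"
    using aff_independent_finite by auto
qed

lemma vertices_convex_hull:
  "\<not> affine_dependent C \<Longrightarrow> vertices (convex hull C) = C"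
  by (auto simp: vertices_def extreme_point_of_convex_hull_affine_independent)

lemma vertices_subset:
  "vertices T \<subseteq> T"
  by (auto simp: vertices_def extreme_point_of_def)

context
  fixes T :: "'a::euclidean_space set"
  assumes T: "int DIM('a) simplex T"
begin

lemma barycentric_family: "barycentric_family T (barycentric T)"
  unfolding barycentric_def by (rule theI'[OF barycentric_family_unique_exists[OF T]])

lemma barycentric_affine:
  assumes "v \<in> vertices T"
  shows "\<exists>a b. \<forall>x. barycentric T v x = a \<bullet> x + b"
  using barycentric_family assms unfolding barycentric_family_def by blast

lemma barycentric_sum: "(\<Sum>v\<in>vertices T. barycentric T v x) = 1"
  using barycentric_family unfolding barycentric_family_def by blast

lemma barycentric_expand: "(\<Sum>v\<in>vertices T. barycentric T v x *\<^sub>R v) = x"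
proof -
  have "\<forall>x. x = (\<Sum>v\<in>vertices T. barycentric T v x *\<^sub>R v)"
    using barycentric_family unfolding barycentric_family_def by blast
  then have "x = (\<Sum>v\<in>vertices T. barycentric T v x *\<^sub>R v)" by blast
  then show ?thesis by (rule sym)
qed

lemma barycentric_affine_sum:
  assumes "v \<in> vertices T" "sum u A = 1"
  shows "barycentric T v (\<Sum>i\<in>A. u i *\<^sub>R z i) = (\<Sum>i\<in>A. u i * barycentric T v (z i))"
proof -
  obtain a b where ab: "\<And>x. barycentric T v x = a \<bullet> x + b"
    using barycentric_affine[OF assms(1)] by blast
  have "(\<Sum>i\<in>A. u i * (a \<bullet> z i + b)) = (\<Sum>i\<in>A. u i * (a \<bullet> z i)) + sum u A * b"
    by (simp add: distrib_left sum.distrib sum_distrib_right)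
  then show ?thesis
    using assms(2) by (simp add: ab inner_sum_right)
qed

text \<open>The constant term of an affine function cancels in a difference. All displacements used
  below have this form.\<close>

lemma barycentric_line:
  assumes "v \<in> vertices T"
  shows "barycentric T v (x + t *\<^sub>R (y - z)) =
    barycentric T v x + t * (barycentric T v y - barycentric T v z)"
proof -
  obtain a b where ab: "\<And>x. barycentric T v x = a \<bullet> x + b"
    using barycentric_affine[OF assms] by blast
  show ?thesis
    by (simp add: ab inner_add_right inner_diff_right)
qed

lemma barycentric_unique:
  assumes "(\<Sum>v\<in>vertices T. u v) = 1" "(\<Sum>v\<in>vertices T. u v *\<^sub>R v) = x" "v \<in> vertices T"
  shows "barycentric T v x = u v"
proof (rule ccontr)
  assume neq: "barycentric T v x \<noteq> u v"
  have "(\<Sum>v\<in>vertices T. barycentric T v x - u v) = 0"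
    using assms(1) by (simp add: sum_subtractf barycentric_sum)
  moreover have "(\<Sum>v\<in>vertices T. (barycentric T v x - u v) *\<^sub>R v) = 0"
    using assms(2) by (simp add: scaleR_left_diff_distrib sum_subtractf barycentric_expand)
  ultimately have "affine_dependent (vertices T)"
    unfolding affine_dependent_explicit_finite[OF simplex_vertices(1)[OF T]]
    using assms(3) neq by (intro exI[of _ "\<lambda>v. barycentric T v x - u v"]) auto
  then show False
    using simplex_vertices(2)[OF T] by blast
qed

lemma barycentric_vertex:
  assumes "v \<in> vertices T" "w \<in> vertices T"
  shows "barycentric T v w = (if v = w then 1 else 0)"
  using assms simplex_vertices(1)[OF T]
  by (intro barycentric_unique) (auto simp: if_distrib[of "\<lambda>c. c *\<^sub>R _"] cong: if_cong)

lemma mem_simplex_iff: "x \<in> T \<longleftrightarrow> (\<forall>v\<in>vertices T. 0 \<le> barycentric T v x)"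
proof
  assume "x \<in> T"
  then have "x \<in> convex hull (vertices T)"
    using simplex_vertices(4)[OF T] by blast
  then obtain u where u: "\<And>v. v \<in> vertices T \<Longrightarrow> 0 \<le> u v" "sum u (vertices T) = 1"
    "(\<Sum>v\<in>vertices T. u v *\<^sub>R v) = x"
    unfolding convex_hull_finite[OF simplex_vertices(1)[OF T]] by auto
  then show "\<forall>v\<in>vertices T. 0 \<le> barycentric T v x"
    using barycentric_unique[OF u(2,3)] by simp
next
  assume "\<forall>v\<in>vertices T. 0 \<le> barycentric T v x"
  then have "x \<in> convex hull (vertices T)"
    unfolding convex_hull_finite[OF simplex_vertices(1)[OF T]]
    by (auto intro!: exI[of _ "\<lambda>v. barycentric T v x"] barycentric_sum barycentric_expand)
  then show "x \<in> T"
    using simplex_vertices(4)[OF T] by blast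
qed

text \<open>The coordinate of \<open>v\<close> is affine and vanishes at every point of
  \<open>C\<close>.\<close>

lemma barycentric_face_zero:
  assumes "C \<subseteq> vertices T" "x \<in> convex hull C" "v \<in> vertices T" "v \<notin> C"
  shows "barycentric T v x = 0"
proof -
  have fin: "finite C"
    using assms(1) simplex_vertices(1)[OF T] finite_subset by blast
  obtain u where u: "sum u C = 1" "(\<Sum>w\<in>C. u w *\<^sub>R w) = x"
    using assms(2) unfolding convex_hull_finite[OF fin] by auto
  have "barycentric T v x = (\<Sum>w\<in>C. u w * barycentric T v w)"
    using barycentric_affine_sum[OF assms(3) u(1), of "\<lambda>w. w"] u(2) by simp
  also have "\<dots> = 0"
    using assms by (intro sum.neutral) (auto simp: barycentric_vertex subset_iff)
  finally show ?thesis .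
qed

lemma convex_full_simplex: "convex T"
  by (subst simplex_vertices(4)[OF T]) (rule convex_convex_hull)

end

section \<open>Coordinates on the star of a vertex\<close>

text \<open>Each expression tends to \<open>g w > 0\<close> as \<open>t\<close> decreases to 0, and
  there are finitely many of them. This allows small pushes that keep given coordinates
  positive.\<close>

lemma finite_positive_perturbation:
  fixes g h :: "'b \<Rightarrow> real"
  assumes "finite A" "\<And>w. w \<in> A \<Longrightarrow> 0 < g w"
  obtains t where "t > 0" "\<And>w. w \<in> A \<Longrightarrow> 0 < g w + t * h w"
proof -
  have "eventually (\<lambda>t. 0 < g w + t * h w) (at_right 0)" if "w \<in> A" for w
  proof (rule order_tendstoD(1))
    show "((\<lambda>t. g w + t * h w) \<longlongrightarrow> g w + 0 * h w) (at_right 0)"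
      by (intro tendsto_intros)
  qed (use assms(2) that in auto)
  then have "eventually (\<lambda>t. \<forall>w\<in>A. 0 < g w + t * h w) (at_right 0)"
    using \<open>finite A\<close> by (simp add: eventually_ball_finite)
  moreover have "eventually (\<lambda>t. 0 < t) (at_right (0::real))"
    by (rule eventually_at_right_less)
  ultimately have "eventually (\<lambda>t. 0 < t \<and> (\<forall>w\<in>A. 0 < g w + t * h w)) (at_right 0)"
    by eventually_elim auto
  then show thesis
    using that eventually_happens'[OF trivial_limit_at_right_real] by blast
qed

context
  fixes \<T> :: "'a::euclidean_space set set" and \<Omega> :: "'a set"
  assumes mesh: "simplicial_mesh \<T> \<Omega>"
begin

lemma mesh_simplex: "T \<in> \<T> \<Longrightarrow> int DIM('a) simplex T"
  using mesh unfolding simplicial_mesh_def by blast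

text \<open>The two simplices meet in a common face containing \<open>q\<close>. A vertex of
  \<open>T\<close> outside that face has coordinate 0 on it, and the vertex set of the face is the
  same seen from either simplex.\<close>

lemma mesh_vertex_shared:
  assumes "T \<in> \<T>" "T' \<in> \<T>" "q \<in> T" "q \<in> T'" "v \<in> vertices T" "barycentric T v q > 0"
  shows "v \<in> vertices T'"
proof -
  note T = mesh_simplex[OF assms(1)] and T' = mesh_simplex[OF assms(2)]
  obtain m where "T \<inter> T' \<in> subsimplices m T \<inter> subsimplices m T'"
    using mesh assms(1-4) unfolding simplicial_mesh_def by blast
  then obtain C C' where C: "C \<subseteq> vertices T" "T \<inter> T' = convex hull C"
    and C': "C' \<subseteq> vertices T'" "T \<inter> T' = convex hull C'"
    unfolding subsimplices_def by blast
  have "\<not> affine_dependent C" "\<not> affine_dependent C'"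
    using C C' simplex_vertices(2)[OF T] simplex_vertices(2)[OF T'] affine_dependent_subset by blast+
  then have "C = C'"
    using C C' vertices_convex_hull by metis
  moreover have "v \<in> C"
    using barycentric_face_zero[OF T C(1), of q v] C assms by auto
  ultimately show ?thesis
    using C' by blast
qed

text \<open>
  If \<open>y\<close> in the star of \<open>v\<close> lay strictly beyond the facet of \<open>T\<close> opposite \<open>v\<close>, then, the star being
  convex, the barycentre \<open>q\<close> of that facet could be pushed away from \<open>v\<close> within the star; the simplex
  reached this way contains \<open>v\<close> and \<open>q\<close>, hence all vertices of \<open>T\<close>.
\<close>
lemma barycentric_nonneg_on_star:
  assumes TT: "T \<in> \<T>" and v: "v \<in> vertices T" and conv: "convex (patch \<T> {v})"
    and y: "y \<in> patch \<T> {v}"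
  shows "0 \<le> barycentric T v y"
proof (rule ccontr)
  let ?b = "barycentric T"
  assume "\<not> 0 \<le> ?b v y"
  then have neg: "?b v y < 0" by simp
  note T = mesh_simplex[OF TT]
  define F where "F = vertices T - {v}"
  define q where "q = (\<Sum>w\<in>F. (1 / real DIM('a)) *\<^sub>R w)"
  have fin: "finite (vertices T)"
    by (rule simplex_vertices(1)[OF T])
  have "card F = DIM('a)"
    using simplex_vertices(3)[OF T] v fin by (simp add: F_def)
  then have F1: "(\<Sum>w\<in>F. 1 / real DIM('a)) = 1"
    by simp
  have bq: "?b w q = (if w = v then 0 else 1 / real DIM('a))" if w: "w \<in> vertices T" for w
  proof -
    have "?b w q = (\<Sum>u\<in>F. 1 / real DIM('a) * ?b w u)"
      unfolding q_def by (rule barycentric_affine_sum[OF T w F1])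
    also have "\<dots> = (\<Sum>u\<in>F. if w = u then 1 / real DIM('a) else 0)"
      using w by (intro sum.cong) (auto simp: F_def barycentric_vertex[OF T])
    finally show ?thesis
      using fin w by (simp add: F_def)
  qed
  \<comment> \<open>Going past \<open>q\<close>, away from \<open>y\<close>, makes the coordinate of
    \<open>v\<close> positive because it is negative at \<open>y\<close>; a small \<open>t\<close>
    keeps the other coordinates positive, so \<open>z\<close> is interior to
    \<open>T\<close>.\<close>
  obtain t where t: "t > 0" and tw: "\<And>w. w \<in> F \<Longrightarrow> 0 < ?b w q + t * (?b w q - ?b w y)"
    by (rule finite_positive_perturbation[of F "\<lambda>w. ?b w q" "\<lambda>w. ?b w q - ?b w y"])
      (use fin bq in \<open>auto simp: F_def\<close>)
  define z where "z = q + t *\<^sub>R (q - y)"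
  have zpos: "0 < ?b w z" if "w \<in> vertices T" for w
  proof (cases "w = v")
    case True
    then show ?thesis
      using t neg bq[OF v] by (simp add: z_def barycentric_line[OF T v] mult_less_0_iff)
  next
    case False
    then show ?thesis
      using that tw[of w] by (simp add: z_def barycentric_line[OF T that] F_def)
  qed
  \<comment> \<open>As \<open>z\<close> is interior, there is room for a further push away from
    \<open>v\<close> inside \<open>T\<close>.\<close>
  obtain s where s: "s > 0" and sw: "\<And>w. w \<in> vertices T \<Longrightarrow> 0 < ?b w z + s * (?b w q - ?b w v)"
    by (rule finite_positive_perturbation[of "vertices T" "\<lambda>w. ?b w z" "\<lambda>w. ?b w q - ?b w v"])
      (use fin zpos in auto)
  define z' where "z' = z + s *\<^sub>R (q - v)"
  have "z' \<in> T"
    unfolding mem_simplex_iff[OF T] z'_def using sw by (auto simp: barycentric_line[OF T] less_imp_le)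
  moreover have vT: "v \<in> T"
    using v vertices_subset by blast
  ultimately have "z' \<in> patch \<T> {v}"
    using TT by (auto simp: patch_def star_def)
  \<comment> \<open>With this value the contribution of \<open>y\<close> cancels:
    \<open>(1 + t) *\<^sub>R q' = z' + t *\<^sub>R y\<close>, so \<open>q'\<close> lies between two
    points of the star.\<close>
  define r where "r = s / (1 + t)"
  define q' where "q' = q + r *\<^sub>R (q - v)"
  have r: "r > 0"
    using s t by (simp add: r_def)
  have "q' = (1 / (1 + t)) *\<^sub>R z' + (t / (1 + t)) *\<^sub>R y"
  proof -
    have "(1 + t) *\<^sub>R q' = z' + t *\<^sub>R y"
      using t by (simp add: q'_def z'_def z_def r_def scaleR_add_right scaleR_add_left
          scaleR_diff_right)
    then have "(1 / (1 + t)) *\<^sub>R ((1 + t) *\<^sub>R q') = (1 / (1 + t)) *\<^sub>R (z' + t *\<^sub>R y)"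
      by simp
    then show ?thesis
      using t by (simp add: scaleR_add_right)
  qed
  then have "q' \<in> patch \<T> {v}"
    using convexD[OF conv \<open>z' \<in> patch \<T> {v}\<close> y, of "1 / (1 + t)" "t / (1 + t)"] t
    by (simp add: field_simps)
  then obtain T' where T': "T' \<in> \<T>" "v \<in> T'" "q' \<in> T'"
    by (auto simp: patch_def star_def)
  \<comment> \<open>The point \<open>q\<close> lies between \<open>q'\<close> and \<open>v\<close>,
    both in \<open>T'\<close>.\<close>
  have "q = (1 / (1 + r)) *\<^sub>R q' + (r / (1 + r)) *\<^sub>R v"
  proof -
    have "(1 + r) *\<^sub>R q = q' + r *\<^sub>R v"
      by (simp add: q'_def algebra_simps)
    then have "(1 / (1 + r)) *\<^sub>R ((1 + r) *\<^sub>R q) = (1 / (1 + r)) *\<^sub>R (q' + r *\<^sub>R v)"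
      by simp
    then show ?thesis
      using r by (simp add: scaleR_add_right)
  qed
  then have "q \<in> T'"
    using convexD[OF convex_full_simplex[OF mesh_simplex[OF T'(1)]] T'(3,2),
        of "1 / (1 + r)" "r / (1 + r)"] r
    by (simp add: field_simps)
  have "q \<in> T"
    unfolding mem_simplex_iff[OF T] using bq by simp
  have "w \<in> vertices T'" if w: "w \<in> vertices T" for w
  proof (cases "w = v")
    case True
    then show ?thesis
      using mesh_vertex_shared[OF TT T'(1) vT T'(2) v] barycentric_vertex[OF T v v] by simp
  next
    case False
    then show ?thesis
      using mesh_vertex_shared[OF TT T'(1) \<open>q \<in> T\<close> \<open>q \<in> T'\<close> w] bq[OF w] by simp
  qed
  then have "vertices T = vertices T'"
    using simplex_vertices[OF T] simplex_vertices[OF mesh_simplex[OF T'(1)]]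
    by (intro card_subset_eq) auto
  then have "T = T'"
    using simplex_vertices(4)[OF T] simplex_vertices(4)[OF mesh_simplex[OF T'(1)]] by metis
  \<comment> \<open>The value is \<open>- r\<close>, whereas \<open>q'\<close> lies in
    \<open>T' = T\<close>.\<close>
  moreover have "?b v q' < 0"
    using r bq[OF v] by (simp add: q'_def barycentric_line[OF T v] barycentric_vertex[OF T v v])
  ultimately show False
    using T' v mem_simplex_iff[OF T] by fastforce
qed

text \<open>Expand \<open>x\<close> in the vertices \<open>w\<close> of \<open>T\<close> and apply
  the affine function \<open>barycentric T' v\<close>. The term \<open>w = v\<close> is the
  left-hand side; the others are nonnegative since each \<open>w\<close> lies in the star of
  \<open>v\<close>.\<close>

lemma barycentric_min_on_star:
  assumes "T \<in> \<T>" "T' \<in> \<T>" "v \<in> vertices T" "v \<in> vertices T'" "convex (patch \<T> {v})" "x \<in> T"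
  shows "barycentric T v x \<le> barycentric T' v x"
proof -
  note T = mesh_simplex[OF assms(1)] and T' = mesh_simplex[OF assms(2)]
  have fin: "finite (vertices T)"
    by (rule simplex_vertices(1)[OF T])
  have "barycentric T v x = barycentric T v x * barycentric T' v v"
    using barycentric_vertex[OF T' assms(4,4)] by simp
  also have "\<dots> \<le> (\<Sum>w\<in>vertices T. barycentric T w x * barycentric T' v w)"
  proof (rule member_le_sum)
    fix w assume "w \<in> vertices T - {v}"
    moreover have "T \<subseteq> patch \<T> {v}"
      using assms(1,3) vertices_subset by (auto simp: patch_def star_def)
    ultimately show "0 \<le> barycentric T w x * barycentric T' v w"
      using assms vertices_subset[of T] mem_simplex_iff[OF T, of x]
        barycentric_nonneg_on_star[OF assms(2,4,5), of w]
      by (intro mult_nonneg_nonneg) auto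
  qed (use assms fin in auto)
  also have "\<dots> = barycentric T' v x"
    using barycentric_affine_sum[OF T' assms(4) barycentric_sum[OF T, of x], where z = "\<lambda>w. w"]
    by (simp add: barycentric_expand[OF T])
  finally show ?thesis .
qed

section \<open>Convexity of the domain and points off the patch\<close>

lemma mesh_union_compact:
  assumes "\<S> \<subseteq> \<T>"
  shows "compact (\<Union>\<S>)"
proof (rule compact_Union)
  show "finite \<S>"
    using mesh assms finite_subset unfolding simplicial_mesh_def by blast
qed (use assms compact_simplex mesh_simplex in blast)

lemma vertex_convexD:
  assumes "vertex_convex \<T>" "T \<in> \<T>" "v \<in> vertices T"
  shows "convex (patch \<T> {v})"
proof -
  have "{v} \<in> subsimplices 0 T"
    using assms(3) unfolding subsimplices_def by (intro CollectI exI[of _ "{v}"]) auto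
  then show ?thesis
    using assms unfolding vertex_convex_def mesh_subsimplices_def by blast
qed

text \<open>
  Near each of its points \<open>\<Omega>\<close> coincides with the convex star of a vertex, so convexity becomes a
  local-to-global statement.
\<close>
lemma vertex_convex_domain_convex:
  assumes vc: "vertex_convex \<T>" and conn: "connected \<Omega>"
  shows "convex \<Omega>"
proof (rule compact_connected_locally_convex_imp_convex)
  have \<Omega>: "\<Omega> = \<Union>\<T>"
    using mesh unfolding simplicial_mesh_def by blast
  show "compact \<Omega>"
    unfolding \<Omega> by (rule mesh_union_compact) simp
  show "connected \<Omega>" by fact
  fix x assume "x \<in> \<Omega>"
  then obtain T where T: "T \<in> \<T>" "x \<in> T"
    using \<Omega> by blast
  note Ts = mesh_simplex[OF T(1)]
  have "\<exists>v\<in>vertices T. barycentric T v x > 0"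
  proof (rule ccontr)
    assume "\<not> (\<exists>v\<in>vertices T. barycentric T v x > 0)"
    then have "(\<Sum>v\<in>vertices T. barycentric T v x) \<le> 0"
      by (intro sum_nonpos) (auto simp: not_less)
    then show False
      using barycentric_sum[OF Ts, of x] by simp
  qed
  then obtain v where v: "v \<in> vertices T" "barycentric T v x > 0"
    by blast
  \<comment> \<open>A ball avoiding this closed set meets only simplices that contain
    \<open>x\<close>, and all of these have \<open>v\<close> as a vertex.\<close>
  define K where "K = \<Union>{T'\<in>\<T>. x \<notin> T'}"
  have "open (- K)"
    unfolding K_def by (intro open_Compl compact_imp_closed mesh_union_compact) auto
  moreover have "x \<in> - K"
    by (auto simp: K_def)
  ultimately obtain e where e: "e > 0" "ball x e \<subseteq> - K"
    using open_contains_ball by blast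
  have "\<Omega> \<inter> ball x e = patch \<T> {v} \<inter> ball x e"
  proof
    show "patch \<T> {v} \<inter> ball x e \<subseteq> \<Omega> \<inter> ball x e"
      by (auto simp: \<Omega> patch_def star_def)
    show "\<Omega> \<inter> ball x e \<subseteq> patch \<T> {v} \<inter> ball x e"
    proof
      fix y assume y: "y \<in> \<Omega> \<inter> ball x e"
      then obtain T' where T': "T' \<in> \<T>" "y \<in> T'"
        using \<Omega> by blast
      then have "x \<in> T'"
        using y e by (auto simp: K_def)
      then have "v \<in> T'"
        using mesh_vertex_shared[OF T(1) T'(1) T(2) _ v] vertices_subset by blast
      then show "y \<in> patch \<T> {v} \<inter> ball x e"
        using y T' by (auto simp: patch_def star_def)
    qed
  qed
  then have "convex (\<Omega> \<inter> ball x e)"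
    using convex_Int[OF vertex_convexD[OF vc T(1) v(1)] convex_ball] by simp
  with e(1) show "\<exists>e>0. convex (\<Omega> \<inter> ball x e)" by blast
qed

text \<open>The simplices containing \<open>p\<close> and the remaining ones give two closed sets
  covering the segment from \<open>p\<close> to \<open>x\<close>. They do not meet on it, so by
  connectedness it stays in the first.\<close>

lemma mem_patch_if_barycentric_pos:
  assumes conv: "convex \<Omega>" and p: "p \<in> \<Omega>" and x: "x \<in> \<Omega>"
    and pC: "p \<in> convex hull C" and C: "\<And>T. T \<in> star \<T> {p} \<Longrightarrow> C \<subseteq> vertices T"
    and pos_p: "\<And>T v. T \<in> star \<T> {p} \<Longrightarrow> v \<in> C \<Longrightarrow> 0 < barycentric T v p"
    and pos_x: "\<And>T v. T \<in> star \<T> {p} \<Longrightarrow> v \<in> C \<Longrightarrow> 0 < barycentric T v x"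
  shows "x \<in> patch \<T> {p}"
proof (rule ccontr)
  assume nx: "x \<notin> patch \<T> {p}"
  have \<Omega>: "\<Omega> = \<Union>\<T>"
    using mesh unfolding simplicial_mesh_def by blast
  define A where "A = patch \<T> {p}"
  define B where "B = \<Union>{T\<in>\<T>. p \<notin> T}"
  have AB: "\<Omega> = A \<union> B"
    by (auto simp: \<Omega> A_def B_def patch_def star_def)
  have "closed A"
    unfolding A_def patch_def star_def by (intro compact_imp_closed mesh_union_compact) auto
  have "closed B"
    unfolding B_def by (intro compact_imp_closed mesh_union_compact) auto
  have "closed_segment p x \<subseteq> A \<union> B"
    using closed_segment_subset[OF p x conv] AB by blast
  moreover have "A \<inter> B \<inter> closed_segment p x = {}"
  proof (rule ccontr)
    assume "A \<inter> B \<inter> closed_segment p x \<noteq> {}"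
    then obtain q T T' where q: "q \<in> closed_segment p x" "q \<in> T" "q \<in> T'"
      and T: "T \<in> star \<T> {p}" and T': "T' \<in> \<T>" "p \<notin> T'"
      by (auto simp: A_def B_def patch_def)
    have TT: "T \<in> \<T>"
      using T by (simp add: star_def)
    note Ts = mesh_simplex[OF TT]
    obtain u where u: "0 \<le> u" "u \<le> 1" "q = (1 - u) *\<^sub>R p + u *\<^sub>R x"
      using q(1) unfolding in_segment by blast
    have "v \<in> T'" if v: "v \<in> C" for v
    proof -
      have vT: "v \<in> vertices T"
        using C[OF T] v by blast
      have q': "q = p + u *\<^sub>R (x - p)"
        using u(3) by (simp add: algebra_simps)
      have "barycentric T v q = (1 - u) * barycentric T v p + u * barycentric T v x"
        unfolding q' barycentric_line[OF Ts vT] by (simp add: algebra_simps)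
      also have "\<dots> > 0"
        using pos_p[OF T v] pos_x[OF T v] u
        by (cases "u = 1") (auto intro: add_pos_nonneg)
      finally have "v \<in> vertices T'"
        by (rule mesh_vertex_shared[OF TT T'(1) q(2,3) vT])
      then show ?thesis
        using vertices_subset by blast
    qed
    then have "convex hull C \<subseteq> T'"
      by (intro hull_minimal convex_full_simplex mesh_simplex[OF T'(1)]) auto
    then show False
      using pC T'(2) by blast
  qed
  ultimately have "A \<inter> closed_segment p x = {} \<or> B \<inter> closed_segment p x = {}"
    using \<open>closed A\<close> \<open>closed B\<close> by (intro connected_closedD connected_segment) auto
  moreover have "p \<in> A"
    using p by (auto simp: \<Omega> A_def patch_def star_def AB B_def)
  moreover have "x \<in> B"
    using nx x AB by (auto simp: A_def)
  ultimately show False by auto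
qed

end

section \<open>The product formula\<close>

text \<open>The factor \<open>j = 0\<close> is split off because it feeds the ReLU product, while
  the others stay in the second product. For \<open>n = 1\<close> the remaining product is
  empty.\<close>

lemma lagrange_factor_shift:
  fixes m :: real
  assumes "0 < n"
  shows "(\<Prod>j<n. c * m - real j) = c * m * (\<Prod>j=1..n - 1. c * m - real j)"
proof -
  have "{..<n} = insert 0 {1..n - 1}"
    using assms by auto
  then show ?thesis by simp
qed

theorem theorem3p1:
  fixes \<Omega> :: "'a::euclidean_space set"
    and \<T> :: "'a set set"
    and k l :: nat
    and p :: 'a
    and f :: "'a set"
    and vf :: "nat \<Rightarrow> 'a"
    and \<alpha> :: "nat \<Rightarrow> nat"
    and V :: "'a set \<Rightarrow> nat \<Rightarrow> 'a"
  assumes domain: "bounded_polytope_domain \<Omega>"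
    and mesh: "simplicial_mesh \<T> \<Omega>"
    and vertex_convex: "vertex_convex \<T>"
    and k: "k \<ge> 1"
    and l: "l \<le> DIM('a)"
    and p_node: "p \<in> mesh_nodes_dim k l \<T>"
    and f_sub: "f \<in> mesh_subsimplices l \<T>"
    and f_conv: "f = convex hull (vf ` {..l})"
    and p_int: "p \<in> rel_interior f"
    and alpha_pos: "\<forall>i\<le>l. \<alpha> i > 0"
    and alpha_zero: "\<forall>i. l < i \<and> i \<le> DIM('a) \<longrightarrow> \<alpha> i = 0"
    and alpha_sum: "(\<Sum>i\<le>l. \<alpha> i) = k"
    and p_eq: "p = (1 / real k) *\<^sub>R (\<Sum>i\<le>l. real (\<alpha> i) *\<^sub>R vf i)"
    and ordering: "\<forall>T\<in>star \<T> {p}. bij_betw (V T) {..DIM('a)} (vertices T) \<and> (\<forall>i\<le>l. V T i = vf i)"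
  shows "\<forall>x\<in>\<Omega>.
    lagrange_basis \<T> k V \<alpha> p x =
      1 / (\<Prod>i\<le>DIM('a). fact (\<alpha> i)) *
      Min ((\<lambda>T. \<Prod>i\<le>l. real k * ReLU (barycentric T (V T i) x)) ` star \<T> {p}) *
      (\<Prod>i\<le>l. \<Prod>j=1..\<alpha> i - 1.
         real k * Min ((\<lambda>T. barycentric T (V T i) x) ` star \<T> {p}) - real j)"
proof
  fix x assume x: "x \<in> \<Omega>"
  define I where "I = star \<T> {p}"
  have \<Omega>: "\<Omega> = \<Union>\<T>" and fin\<T>: "finite \<T>"
    using mesh unfolding simplicial_mesh_def by blast+
  have finI: "finite I"
    using fin\<T> by (simp add: I_def star_def)
  have I\<T>: "T \<in> \<T>" if "T \<in> I" for T
    using that by (simp add: I_def star_def)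
  have IV: "V T i = vf i" if "T \<in> I" "i \<le> l" for T i
    using that ordering by (simp add: I_def)
  have vf_vert: "vf i \<in> vertices T" if "T \<in> I" "i \<le> l" for T i
  proof -
    have "bij_betw (V T) {..DIM('a)} (vertices T)"
      using ordering that(1) by (simp add: I_def)
    then have "V T i \<in> vertices T"
      using l that(2) by (auto dest: bij_betwE)
    then show ?thesis
      by (simp add: IV[OF that])
  qed
  have vf_inj: "vf i = vf j \<longleftrightarrow> i = j" if "T \<in> I" "i \<le> l" "j \<le> l" for T i j
  proof -
    have "inj_on (V T) {..DIM('a)}"
      using ordering that(1) by (auto simp: I_def bij_betw_def)
    then have "V T i = V T j \<longleftrightarrow> i = j"
      using l that by (intro inj_on_eq_iff) auto
    then show ?thesis
      using IV that by simp
  qed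
  have pf: "p \<in> convex hull (vf ` {..l})"
    using p_int rel_interior_subset f_conv by blast
  have "\<exists>T\<in>\<T>. p \<in> T"
  proof -
    obtain T C where T: "T \<in> \<T>" "f = convex hull C" "C \<subseteq> vertices T"
      using f_sub unfolding mesh_subsimplices_def subsimplices_def by blast
    then have "f \<subseteq> T"
      using hull_mono[OF T(3), of convex] simplex_vertices(4)[OF mesh_simplex[OF mesh T(1)]]
      by simp
    then show ?thesis
      using T pf f_conv by blast
  qed
  \<comment> \<open>Nonemptiness gives the minima over \<open>I\<close> a meaning.\<close>
  then have I_ne: "I \<noteq> {}" and p\<Omega>: "p \<in> \<Omega>"
    by (auto simp: I_def star_def \<Omega>)
  \<comment> \<open>The coordinate is \<open>\<alpha> i / k\<close>, in every simplex of the
    star.\<close>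
  have pos_p: "0 < barycentric T (vf i) p" if T: "T \<in> I" and i: "i \<le> l" for T i
  proof -
    have sum1: "(\<Sum>j\<le>l. real (\<alpha> j) / real k) = 1"
      using alpha_sum k by (simp flip: sum_divide_distrib of_nat_sum)
    have "p = (\<Sum>j\<le>l. (real (\<alpha> j) / real k) *\<^sub>R vf j)"
      using p_eq by (simp add: scaleR_right.sum)
    then have "barycentric T (vf i) p = (\<Sum>j\<le>l. real (\<alpha> j) / real k * barycentric T (vf i) (vf j))"
      using barycentric_affine_sum[OF mesh_simplex[OF mesh I\<T>[OF T]] vf_vert[OF T i] sum1] by simp
    also have "\<dots> = (\<Sum>j\<le>l. if i = j then real (\<alpha> j) / real k else 0)"
      using barycentric_vertex[OF mesh_simplex[OF mesh I\<T>[OF T]]] vf_vert T i vf_inj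
      by (intro sum.cong) auto
    also have "\<dots> = real (\<alpha> i) / real k"
      using i by simp
    also have "\<dots> > 0"
      using alpha_pos i k by simp
    finally show ?thesis .
  qed
  let ?P = "\<lambda>T. \<Prod>i\<le>l. real k * ReLU (barycentric T (V T i) x)"
  let ?m = "\<lambda>i. Min ((\<lambda>T. barycentric T (V T i) x) ` I)"
  let ?R = "1 / (\<Prod>i\<le>DIM('a). fact (\<alpha> i)) * Min (?P ` I) *
      (\<Prod>i\<le>l. \<Prod>j=1..\<alpha> i - 1. real k * ?m i - real j)"
  have "lagrange_basis \<T> k V \<alpha> p x = ?R"
  proof (cases "x \<in> patch \<T> {p}")
    case True
    \<comment> \<open>The right-hand side does not depend on \<open>T\<close>, so this also shows
      that the local formulas agree and the definite description is well defined.\<close>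
    have local_eq: "lagrange_local k V \<alpha> T x = ?R" if T: "T \<in> I" "x \<in> T" for T
    proof -
      have le: "barycentric T (V T i) x \<le> barycentric T' (V T' i) x" if "T' \<in> I" "i \<le> l" for T' i
        using barycentric_min_on_star[OF mesh I\<T>[OF T(1)] I\<T>[OF that(1)]
            vf_vert[OF T(1) that(2)] vf_vert[OF that]
            vertex_convexD[OF mesh vertex_convex I\<T>[OF that(1)] vf_vert[OF that]] T(2)]
          IV that T by simp
      have m: "?m i = barycentric T (V T i) x" if "i \<le> l" for i
        using le that T finI by (intro Min_eqI) auto
      have nonneg: "0 \<le> barycentric T (V T i) x" if "i \<le> l" for i
        using mem_simplex_iff[OF mesh_simplex[OF mesh I\<T>[OF T(1)]], of x] T(2)
          vf_vert[OF T(1) that] IV[OF T(1) that] by simp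
      \<comment> \<open>On \<open>T\<close> all factors are smallest simultaneously and nonnegative,
        so the minimum of the products is the product of the minima.\<close>
      have "Min (?P ` I) = ?P T"
      proof (intro Min_eqI)
        fix y assume "y \<in> ?P ` I"
        then obtain T' where "T' \<in> I" "y = ?P T'" by blast
        then show "?P T \<le> y"
          using le by (auto intro!: prod_mono mult_left_mono simp: ReLU_def max.coboundedI2)
      qed (use finI T in auto)
      also have "\<dots> = (\<Prod>i\<le>l. real k * ?m i)"
        using nonneg m by (intro prod.cong) (auto simp: ReLU_def)
      finally have "?R = 1 / (\<Prod>i\<le>DIM('a). fact (\<alpha> i)) *
          (\<Prod>i\<le>l. real k * ?m i * (\<Prod>j=1..\<alpha> i - 1. real k * ?m i - real j))"
        by (simp add: prod.distrib)
      also have "(\<Prod>i\<le>l. real k * ?m i * (\<Prod>j=1..\<alpha> i - 1. real k * ?m i - real j)) =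
          (\<Prod>i\<le>l. \<Prod>j<\<alpha> i. real k * barycentric T (V T i) x - real j)"
        using alpha_pos m by (intro prod.cong refl) (simp add: lagrange_factor_shift)
      \<comment> \<open>Beyond \<open>l\<close> the index is 0 and the inner products are
        empty.\<close>
      also have "\<dots> = (\<Prod>i\<le>DIM('a). \<Prod>j<\<alpha> i. real k * barycentric T (V T i) x - real j)"
        using l alpha_zero by (intro prod.mono_neutral_left) auto
      finally show ?thesis
        unfolding lagrange_local_def by (rule sym)
    qed
    obtain T where "T \<in> I" "x \<in> T"
      using True by (auto simp: patch_def I_def)
    then have "(THE y. \<forall>T\<in>I. x \<in> T \<longrightarrow> y = lagrange_local k V \<alpha> T x) = ?R"
      using local_eq by (intro the_equality) auto
    then show ?thesis
      using True by (simp add: lagrange_basis_def I_def)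
  next
    case False
    have "\<exists>T\<in>I. \<exists>i\<le>l. barycentric T (vf i) x \<le> 0"
    proof (rule ccontr)
      assume "\<not> ?thesis"
      then have *: "0 < barycentric T (vf i) x" if "T \<in> I" "i \<le> l" for T i
        using that by (meson not_le)
      have "connected \<Omega>"
        using domain unfolding bounded_polytope_domain_def
        by (auto intro: connected_imp_connected_closure)
      then have "convex \<Omega>"
        by (rule vertex_convex_domain_convex[OF mesh vertex_convex])
      then have "x \<in> patch \<T> {p}"
        by (rule mem_patch_if_barycentric_pos[OF mesh _ p\<Omega> x pf])
          (use * pos_p vf_vert in \<open>auto simp: I_def\<close>)
      with False show False by blast
    qed
    then obtain T i where T: "T \<in> I" "i \<le> l" "barycentric T (vf i) x \<le> 0"
      by blast
    \<comment> \<open>One nonpositive coordinate kills its ReLU factor; as all products are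
      nonnegative, the minimum is 0 whatever the second product is.\<close>
    then have "?P T = 0"
      using IV by (intro prod_zero) (auto simp: ReLU_def intro!: bexI[of _ i])
    then have "Min (?P ` I) = 0"
      using T finI by (intro Min_eqI) (auto simp: ReLU_def intro!: prod_nonneg image_eqI[of _ _ T])
    then show ?thesis
      using False by (simp add: lagrange_basis_def)
  qed
  then show "lagrange_basis \<T> k V \<alpha> p x =
      1 / (\<Prod>i\<le>DIM('a). fact (\<alpha> i)) *
      Min ((\<lambda>T. \<Prod>i\<le>l. real k * ReLU (barycentric T (V T i) x)) ` star \<T> {p}) *
      (\<Prod>i\<le>l. \<Prod>j=1..\<alpha> i - 1.
         real k * Min ((\<lambda>T. barycentric T (V T i) x) ` star \<T> {p}) - real j)"
    by (simp only: I_def)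
qed

end
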